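(* Let $E$ be an orbit equivalence relation induced by a Borel action $a\colon G\times Z\to Z$ of a Polish group $G$ on a standard Borel space $Z$, and let $F\supseteq E$ be any equivalence relation on $Z$. If there is a Borel map $\theta\colon Z\to Z$ selecting an $E$-class within every $F$-class, then $F$ is idealistic.
   Context: For equivalence relations $F'\subseteq F$ on the same set $Z$, a map $\theta\colon Z\to Z$ selects an $F'$-class within each $F$-class if $\theta$ is a homomorphism from $F$ to $F'$ (that is, $z\mathrel{F}z'\Rightarrow\theta(z)\mathrel{F'}\theta(z')$) and $\theta(z)\mathrel{F}z$ for all $z\in Z$. An analytic equivalence relation $E$ on a standard Borel space $X$ is idealistic if there is a map assigning to each class $C\in X/E$ a $\sigma$-ideal $I_C$ of subsets of $C$ with $C\notin I_C$ which is ccc (every family of pairwise disjoint relatively Borel subsets of $C$ none of which is in $I_C$ is countable) and such that $C\mapsto I_C$ is Borel, in the sense that for each Borel $A\subseteq X^2$ the set $\{x\in X: \{y\in[x]_E:(x,y)\in A\}\in I_{[x]_E}\}$ is Borel. *)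

theory Defs
  imports "HOL-Analysis.Analysis" "HOL-Algebra.Group_Action"
begin

text \<open>
  Throughout, a value of type \<open>'a measure\<close> is used only as a measurable space, through
  \<^const>\<open>space\<close> and \<^const>\<open>sets\<close>; the measure it carries plays no role.
  Relations on a set are sets of pairs, as in \<^const>\<open>equiv\<close>.
\<close>

definition polish_topology :: "'a topology \<Rightarrow> bool" where
  "polish_topology T \<longleftrightarrow> completely_metrizable_space T \<and> separable_space T"

definition borel_of :: "'a topology \<Rightarrow> 'a measure" where
  "borel_of T = sigma (topspace T) {U. openin T U}"

definition standard_borel :: "'a measure \<Rightarrow> bool" where
  "standard_borel M \<longleftrightarrow>
     (\<exists>T. polish_topology T \<and> space M = topspace T \<and> sets M = sets (borel_of T))"

text \<open>
  An analytic subset of a standard Borel space \<open>M\<close> is the projection of a Borel subset of the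
  product of \<open>M\<close> with the Baire space. Here \<open>nat \<Rightarrow> nat\<close> carries the product topology of the
  discrete topologies.
\<close>

definition analytic_in :: "'a measure \<Rightarrow> 'a set \<Rightarrow> bool" where
  "analytic_in M A \<longleftrightarrow>
     (\<exists>B \<in> sets (M \<Otimes>\<^sub>M (borel :: (nat \<Rightarrow> nat) measure)). A = fst ` B)"

definition polish_group :: "('g, 'b) monoid_scheme \<Rightarrow> 'g topology \<Rightarrow> bool" where
  "polish_group G T \<longleftrightarrow>
     group G \<and> polish_topology T \<and> topspace T = carrier G \<and>
     continuous_map (prod_topology T T) T (\<lambda>(g, h). g \<otimes>\<^bsub>G\<^esub> h) \<and>
     continuous_map T T (\<lambda>g. inv\<^bsub>G\<^esub> g)"

text \<open>
  The library notion \<^locale>\<open>group_action\<close> asks each \<open>a g\<close> to be extensional, that is, to take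
  the value \<^const>\<open>undefined\<close> outside \<open>space Z\<close>. This only fixes irrelevant values.
\<close>

definition borel_action ::
    "('g, 'b) monoid_scheme \<Rightarrow> 'g topology \<Rightarrow> 'z measure \<Rightarrow> ('g \<Rightarrow> 'z \<Rightarrow> 'z) \<Rightarrow> bool" where
  "borel_action G T Z a \<longleftrightarrow>
     group_action G (space Z) a \<and> (\<lambda>(g, z). a g z) \<in> borel_of T \<Otimes>\<^sub>M Z \<rightarrow>\<^sub>M Z"

definition orbit_equivalence ::
    "('g, 'b) monoid_scheme \<Rightarrow> 'z set \<Rightarrow> ('g \<Rightarrow> 'z \<Rightarrow> 'z) \<Rightarrow> ('z \<times> 'z) set" where
  "orbit_equivalence G S a = {(x, y). x \<in> S \<and> y \<in> orbit G a x}"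

text \<open>\<open>\<theta>\<close> selects an \<open>F'\<close>-class within each \<open>F\<close>-class; intended for equivalence relations
  \<open>F' \<subseteq> F\<close> on \<open>S\<close>.\<close>

definition selects_class ::
    "'z set \<Rightarrow> ('z \<times> 'z) set \<Rightarrow> ('z \<times> 'z) set \<Rightarrow> ('z \<Rightarrow> 'z) \<Rightarrow> bool" where
  "selects_class S F' F \<theta> \<longleftrightarrow>
     \<theta> \<in> S \<rightarrow> S \<and> (\<forall>z z'. (z, z') \<in> F \<longrightarrow> (\<theta> z, \<theta> z') \<in> F') \<and> (\<forall>z\<in>S. (\<theta> z, z) \<in> F)"

definition sigma_ideal_on :: "'a set \<Rightarrow> 'a set set \<Rightarrow> bool" where
  "sigma_ideal_on C I \<longleftrightarrow>
     I \<subseteq> Pow C \<and> {} \<in> I \<and> (\<forall>A B. A \<in> I \<and> B \<subseteq> A \<longrightarrow> B \<in> I) \<and>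
     (\<forall>A :: nat \<Rightarrow> 'a set. range A \<subseteq> I \<longrightarrow> (\<Union>n. A n) \<in> I)"

definition ccc_ideal :: "'a measure \<Rightarrow> 'a set \<Rightarrow> 'a set set \<Rightarrow> bool" where
  "ccc_ideal M C I \<longleftrightarrow>
     (\<forall>\<A>. \<A> \<subseteq> sets (restrict_space M C) \<and> disjoint \<A> \<and> \<A> \<inter> I = {} \<longrightarrow> countable \<A>)"

definition idealistic :: "'a measure \<Rightarrow> ('a \<times> 'a) set \<Rightarrow> bool" where
  "idealistic X E \<longleftrightarrow>
     standard_borel X \<and> equiv (space X) E \<and> analytic_in (X \<Otimes>\<^sub>M X) E \<and>
     (\<exists>I :: 'a set \<Rightarrow> 'a set set.
        (\<forall>C \<in> space X // E. sigma_ideal_on C (I C) \<and> C \<notin> I C \<and> ccc_ideal X C (I C)) \<and>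
        (\<forall>A \<in> sets (X \<Otimes>\<^sub>M X).
           {x \<in> space X. {y \<in> E `` {x}. (x, y) \<in> A} \<in> I (E `` {x})} \<in> sets X))"

end

theory Submission
  imports Defs
begin

text \<open>
  Let \<open>C\<close> be an \<open>F\<close>-class. Since \<open>\<theta>\<close> maps \<open>C\<close> into a single orbit, and that orbit lies inside \<open>C\<close>,
  the class carries a notion of smallness borrowed from the group: a subset \<open>A\<close> of \<open>C\<close> is small when
  \<open>{g. a g (\<theta> z) \<in> A}\<close> is meagre in the group, for \<open>z\<close> in \<open>C\<close>. The points \<open>\<theta> z\<close> and \<open>\<theta> z'\<close> differ by
  a group element, so the two sets of group elements differ by a right translation, which is a
  homeomorphism; hence the choice of \<open>z\<close> is immaterial (\<open>orbit_meagre_orbit_cong\<close>).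
  
  The small sets form the required ideal. Countable unions of meagre sets are meagre, and \<open>C\<close> itself
  is not small by the Baire category theorem, its preimage being the whole group. The chain condition
  is that of the meagre ideal (\<open>nonmeagre_disjoint_family_countable\<close>): Borel sets have the Baire
  property, so disjoint nonmeagre ones are comeagre in distinct members of a countable base. That the
  ideals depend on the class in a Borel way is the theorem of Montgomery and Novikov on meagre
  sections (\<open>measurable_meagre_sections\<close>), applied to the Borel set of pairs \<open>(x, g)\<close> with
  \<open>(x, a g (\<theta> x)) \<in> A\<close>.
  
  Finally \<open>F\<close> is analytic: \<open>x\<close> and \<open>y\<close> are equivalent exactly when \<open>\<theta> x\<close> and \<open>\<theta> y\<close> lie in the same
  orbit, that is, when some group element moves the one to the other. To put the existential
  quantifier over the Baire space, the group is parametrised by a Borel map from that space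
  (\<open>polish_borel_image_of_Baire_space\<close>).
\<close>

section \<open>Baire category and the Baire property\<close>

definition meagre_in :: "'a topology \<Rightarrow> 'a set \<Rightarrow> bool" where
  "meagre_in T A \<longleftrightarrow>
     (\<exists>\<N>. countable \<N> \<and> (\<forall>N\<in>\<N>. closedin T N \<and> T interior_of N = {}) \<and> A \<subseteq> \<Union>\<N>)"

lemma meagre_in_subset: "meagre_in T B \<Longrightarrow> A \<subseteq> B \<Longrightarrow> meagre_in T A"
  unfolding meagre_in_def by (meson subset_trans)

lemma meagre_in_empty [simp]: "meagre_in T {}"
  unfolding meagre_in_def by (intro exI[of _ "{}"]) auto

lemma meagre_in_closed: "closedin T N \<Longrightarrow> T interior_of N = {} \<Longrightarrow> meagre_in T N"
  unfolding meagre_in_def by (intro exI[of _ "{N}"]) auto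

lemma meagre_in_UN:
  assumes "countable I" and "\<And>i. i \<in> I \<Longrightarrow> meagre_in T (A i)"
  shows "meagre_in T (\<Union>i\<in>I. A i)"
proof -
  have "\<forall>i\<in>I. \<exists>\<N>. countable \<N> \<and> (\<forall>N\<in>\<N>. closedin T N \<and> T interior_of N = {}) \<and> A i \<subseteq> \<Union>\<N>"
    using assms(2) unfolding meagre_in_def by blast
  then obtain \<N> where \<N>: "\<forall>i\<in>I. countable (\<N> i) \<and>
      (\<forall>N\<in>\<N> i. closedin T N \<and> T interior_of N = {}) \<and> A i \<subseteq> \<Union>(\<N> i)"
    by (elim exE[OF bchoice])
  show ?thesis
    unfolding meagre_in_def
  proof (intro exI[of _ "\<Union>i\<in>I. \<N> i"] conjI ballI)
    show "countable (\<Union>i\<in>I. \<N> i)"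
      using \<N> assms(1) by auto
  next
    fix N assume "N \<in> (\<Union>i\<in>I. \<N> i)"
    then obtain i where "i \<in> I" "N \<in> \<N> i"
      by (rule UN_E)
    then show "closedin T N" "T interior_of N = {}"
      using bspec[OF \<N>, of i] by simp_all
  next
    show "(\<Union>i\<in>I. A i) \<subseteq> \<Union>(\<Union>i\<in>I. \<N> i)"
    proof (rule UN_least)
      fix i assume "i \<in> I"
      then have "A i \<subseteq> \<Union>(\<N> i)" "\<N> i \<subseteq> (\<Union>i\<in>I. \<N> i)"
        using bspec[OF \<N>, of i] by auto
      then show "A i \<subseteq> \<Union>(\<Union>i\<in>I. \<N> i)"
        by (meson Union_mono subset_trans)
    qed
  qed
qed

lemma meagre_in_Un: "meagre_in T A \<Longrightarrow> meagre_in T B \<Longrightarrow> meagre_in T (A \<union> B)"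
  using meagre_in_UN[of "{A, B}" T "\<lambda>X. X"] by auto

lemma meagre_in_open_imp_empty:
  assumes "completely_metrizable_space T" and "openin T U" and "meagre_in T U"
  shows "U = {}"
proof -
  obtain \<N> where \<N>: "countable \<N>" "\<And>N. N \<in> \<N> \<Longrightarrow> closedin T N \<and> T interior_of N = {}"
      "U \<subseteq> \<Union>\<N>"
    using assms(3) unfolding meagre_in_def by blast
  have "T interior_of \<Union>\<N> = {}"
    using Baire_category_alt[of T \<N>] assms(1) \<N>(1,2) by blast
  then show ?thesis
    using interior_of_maximal[OF \<N>(3) assms(2)] by simp
qed

text \<open>
  Applied to right translations of a Polish group: it makes meagreness of a set of group elements
  independent of the point of an orbit that is used to pull the set back.
\<close>

lemma meagre_in_homeomorphic_image:
  assumes f: "homeomorphic_map S T f" and A: "meagre_in S A"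
  shows "meagre_in T (f ` A)"
proof -
  obtain \<N> where \<N>: "countable \<N>" "\<And>N. N \<in> \<N> \<Longrightarrow> closedin S N \<and> S interior_of N = {}"
      "A \<subseteq> \<Union>\<N>"
    using A unfolding meagre_in_def by blast
  have "meagre_in T (\<Union>N\<in>\<N>. f ` N)"
  proof (rule meagre_in_UN[OF \<N>(1)])
    fix N assume "N \<in> \<N>"
    with \<N>(2) have N: "closedin S N" "S interior_of N = {}"
      by auto
    show "meagre_in T (f ` N)"
      using homeomorphic_map_closedness[OF f closedin_subset[OF N(1)]]
        homeomorphic_map_interior_of[OF f closedin_subset[OF N(1)]] N
      by (intro meagre_in_closed) simp_all
  qed
  then show ?thesis
    by (rule meagre_in_subset) (use \<N>(3) in blast)
qed

definition baire_property :: "'a topology \<Rightarrow> 'a set \<Rightarrow> bool" where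
  "baire_property T A \<longleftrightarrow> (\<exists>U. openin T U \<and> meagre_in T ((A - U) \<union> (U - A)))"

lemma space_borel_of [simp]: "space (borel_of T) = topspace T"
  and sets_borel_of: "sets (borel_of T) = sigma_sets (topspace T) {U. openin T U}"
  unfolding borel_of_def
  by (auto intro!: space_measure_of sets_measure_of dest: openin_subset)

lemma open_in_sets_borel_of: "openin T U \<Longrightarrow> U \<in> sets (borel_of T)"
  unfolding sets_borel_of by (auto intro: sigma_sets.Basic)

text \<open>
  If \<open>A\<close> agrees with the open set \<open>U\<close> modulo a meagre set, its complement agrees with the closed
  set \<open>C\<close> complementary to \<open>U\<close>, and \<open>C\<close> differs from its interior by the boundary of \<open>C\<close>, which is
  closed with empty interior.
\<close>

lemma baire_property_Compl:
  assumes "baire_property T A"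
  shows "baire_property T (topspace T - A)"
proof -
  obtain U where U: "openin T U" "meagre_in T ((A - U) \<union> (U - A))"
    using assms unfolding baire_property_def by blast
  define C where "C = topspace T - U"
  have C: "closedin T C"
    unfolding C_def using U(1) by auto
  have "closedin T (C - T interior_of C)"
    using C by auto
  moreover have "T interior_of (C - T interior_of C) = {}"
  proof -
    have "T interior_of (C - T interior_of C) \<subseteq> T interior_of C"
      by (intro interior_of_mono) auto
    then show ?thesis
      using interior_of_subset[of T "C - T interior_of C"] by blast
  qed
  ultimately have "meagre_in T (C - T interior_of C)"
    by (rule meagre_in_closed)
  from meagre_in_Un[OF U(2) this] show ?thesis
    unfolding baire_property_def
    by (intro exI[of _ "T interior_of C"] conjI openin_interior_of)
       (erule meagre_in_subset, use interior_of_subset[of T C] C_def in blast)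
qed

lemma baire_property_UN:
  fixes A :: "nat \<Rightarrow> 'a set"
  assumes "\<And>n. baire_property T (A n)"
  shows "baire_property T (\<Union>n. A n)"
proof -
  obtain U where U: "\<And>n. openin T (U n)" "\<And>n. meagre_in T ((A n - U n) \<union> (U n - A n))"
    using assms unfolding baire_property_def by metis
  have "meagre_in T (\<Union>n. (A n - U n) \<union> (U n - A n))"
    by (intro meagre_in_UN U(2)) auto
  then show ?thesis
    unfolding baire_property_def
    by (intro exI[of _ "\<Union>n. U n"] conjI) (use U(1) in blast, erule meagre_in_subset, blast)
qed

lemma borel_imp_baire_property:
  assumes "A \<in> sets (borel_of T)"
  shows "baire_property T A"
  using assms unfolding sets_borel_of
proof (induction rule: sigma_sets.induct)
  case (Basic U)
  then show ?case unfolding baire_property_def by (intro exI[of _ U]) auto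
next
  case Empty
  then show ?case unfolding baire_property_def by (intro exI[of _ "{}"]) auto
next
  case (Compl A)
  then show ?case by (intro baire_property_Compl)
next
  case (Union A)
  then show ?case by (intro baire_property_UN)
qed

section \<open>Category in second countable spaces\<close>

lemma polish_imp_second_countable:
  assumes "polish_topology T"
  shows "second_countable T"
proof -
  obtain M d where M: "Metric_space M d" "T = Metric_space.mtopology M d"
    using assms unfolding polish_topology_def completely_metrizable_space_def by blast
  interpret Metric_space M d by (rule M)
  obtain C where C: "countable C" "C \<subseteq> M" "mtopology closure_of C = M"
    using assms unfolding polish_topology_def separable_space_def M(2) by auto
  define \<B> where "\<B> = (\<lambda>(c, n). mball c (1 / real (Suc n))) ` (C \<times> (UNIV :: nat set))"
  have "\<exists>V\<in>\<B>. x \<in> V \<and> V \<subseteq> U" if U: "openin mtopology U" "x \<in> U" for U x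
  proof -
    obtain r where r: "r > 0" "mball x r \<subseteq> U" and "x \<in> M"
      using U unfolding openin_mtopology by blast
    obtain n where n: "1 / real (Suc n) < r / 2"
      using r(1) nat_approx_posE[of "r / 2"] by auto
    have "C \<inter> mball x (1 / real (Suc n)) \<noteq> {}"
      using C(3) dense_intersects_open[of mtopology C] \<open>x \<in> M\<close>
      by (auto simp: mball_eq_empty)
    then obtain c where c: "c \<in> C" "c \<in> M" "d x c < 1 / real (Suc n)"
      by auto
    have "mball c (1 / real (Suc n)) \<subseteq> mball x r"
      using c n \<open>x \<in> M\<close> by (intro mball_subset) (auto simp: commute)
    with r c \<open>x \<in> M\<close> show ?thesis
      unfolding \<B>_def by (intro bexI[of _ "mball c (1 / real (Suc n))"]) (auto simp: commute)
  qed
  then show ?thesis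
    unfolding second_countable_def M(2)
    by (intro exI[of _ \<B>]) (auto simp: \<B>_def C(1))
qed

text \<open>
  The countable chain condition of the meagre ideal. Each set \<open>P A\<close> is comeagre in some nonempty
  member \<open>V A\<close> of a fixed countable base. If \<open>V A = V B\<close> for disjoint \<open>P A\<close> and \<open>P B\<close>, then \<open>V A\<close>
  is covered by the meagre sets \<open>V A - P A\<close> and \<open>V B - P B\<close>, against the Baire category theorem; so
  \<open>V\<close> is an injection into the base. The family is indexed because it will consist of preimages
  under an orbit map, while countability is wanted for the sets downstairs.
\<close>

lemma nonmeagre_disjoint_family_countable:
  assumes T: "polish_topology T"
    and BP: "\<And>A. A \<in> \<A> \<Longrightarrow> baire_property T (P A)"
    and nonmeagre: "\<And>A. A \<in> \<A> \<Longrightarrow> \<not> meagre_in T (P A)"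
    and disj: "\<And>A B. A \<in> \<A> \<Longrightarrow> B \<in> \<A> \<Longrightarrow> A \<noteq> B \<Longrightarrow> P A \<inter> P B = {}"
  shows "countable \<A>"
proof -
  obtain \<B> where \<B>: "countable \<B>" "\<And>V. V \<in> \<B> \<Longrightarrow> openin T V"
      "\<And>U x. openin T U \<Longrightarrow> x \<in> U \<Longrightarrow> \<exists>V\<in>\<B>. x \<in> V \<and> V \<subseteq> U"
    using polish_imp_second_countable[OF T] unfolding second_countable_def by metis
  have "\<exists>V. V \<in> \<B> \<and> V \<noteq> {} \<and> meagre_in T (V - P A)" if A: "A \<in> \<A>" for A
  proof -
    obtain U where U: "openin T U" "meagre_in T ((P A - U) \<union> (U - P A))"
      using BP[OF A] unfolding baire_property_def by blast
    have "U \<noteq> {}"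
      using U(2) nonmeagre[OF A] by auto
    then obtain x where "x \<in> U"
      by blast
    then obtain V where "V \<in> \<B>" "x \<in> V" "V \<subseteq> U"
      using \<B>(3)[OF U(1)] by blast
    then show ?thesis
      by (intro exI[of _ V]) (auto intro: meagre_in_subset[OF U(2)])
  qed
  then obtain V where V: "\<And>A. A \<in> \<A> \<Longrightarrow> V A \<in> \<B> \<and> V A \<noteq> {} \<and> meagre_in T (V A - P A)"
    by metis
  have "inj_on V \<A>"
  proof (rule inj_onI, rule ccontr)
    fix A B assume AB: "A \<in> \<A>" "B \<in> \<A>" "V A = V B" "A \<noteq> B"
    have "meagre_in T ((V A - P A) \<union> (V B - P B))"
      using V[OF AB(1)] V[OF AB(2)] by (intro meagre_in_Un) simp_all
    then have "meagre_in T (V A)"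
      by (rule meagre_in_subset) (use AB disj in blast)
    with V[OF AB(1)] \<B>(2) T show False
      using meagre_in_open_imp_empty unfolding polish_topology_def by blast
  qed
  moreover have "V ` \<A> \<subseteq> \<B>"
    using V by blast
  ultimately show ?thesis
    using \<B>(1) by (meson countable_image_inj_on countable_subset)
qed

text \<open>
  This trades a complement for countably many negations, one for each basic open subset of \<open>U\<close>:
  it is the complement step in the induction that shows the category quantifier to preserve Borel
  sets. For the harder direction, if \<open>U - A\<close> were not meagre, it would be comeagre in a nonempty
  open subset of \<open>U\<close>, and \<open>A\<close> would be meagre there.
\<close>

lemma meagre_in_diff_iff:
  assumes T: "completely_metrizable_space T"
    and base: "\<And>V. V \<in> \<B> \<Longrightarrow> openin T V"
      "\<And>U x. openin T U \<Longrightarrow> x \<in> U \<Longrightarrow> \<exists>V\<in>\<B>. x \<in> V \<and> V \<subseteq> U"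
    and A: "baire_property T A" and U: "openin T U"
  shows "meagre_in T (U - A) \<longleftrightarrow> (\<forall>V\<in>\<B>. V \<noteq> {} \<and> V \<subseteq> U \<longrightarrow> \<not> meagre_in T (V \<inter> A))"
proof
  assume m: "meagre_in T (U - A)"
  show "\<forall>V\<in>\<B>. V \<noteq> {} \<and> V \<subseteq> U \<longrightarrow> \<not> meagre_in T (V \<inter> A)"
  proof (intro ballI impI notI)
    fix V assume V: "V \<in> \<B>" "V \<noteq> {} \<and> V \<subseteq> U" "meagre_in T (V \<inter> A)"
    have "meagre_in T V"
      using meagre_in_Un[OF m V(3)] by (rule meagre_in_subset) (use V in blast)
    then show False
      using meagre_in_open_imp_empty[OF T base(1)] V by blast
  qed
next
  assume r: "\<forall>V\<in>\<B>. V \<noteq> {} \<and> V \<subseteq> U \<longrightarrow> \<not> meagre_in T (V \<inter> A)"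
  obtain W where W: "openin T W"
      "meagre_in T (((topspace T - A) - W) \<union> (W - (topspace T - A)))"
    using baire_property_Compl[OF A] unfolding baire_property_def by blast
  have "W \<inter> U = {}"
  proof (rule ccontr)
    assume "W \<inter> U \<noteq> {}"
    then obtain x where "x \<in> W \<inter> U"
      by blast
    then obtain V where V: "V \<in> \<B>" "x \<in> V" "V \<subseteq> W \<inter> U"
      using base(2)[of "W \<inter> U" x] W(1) U by (meson openin_Int)
    have "meagre_in T (V \<inter> A)"
      using W(2) by (rule meagre_in_subset) (use V in blast)
    with r V show False
      by blast
  qed
  then show "meagre_in T (U - A)"
    using openin_subset[OF U] by (intro meagre_in_subset[OF W(2)]) blast
qed

text \<open>
  The theorem of Montgomery and Novikov: the category quantifier maps Borel sets to Borel sets.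
  The sets whose sections behave well contain the measurable rectangles and are closed under
  countable unions, as meagreness of a union means meagreness of all members; complements are handled
  by \<open>meagre_in_diff_iff\<close>, which applies because sections of Borel sets have the Baire property.
\<close>

lemma measurable_meagre_sections:
  assumes T: "polish_topology T" and B: "B \<in> sets (Z \<Otimes>\<^sub>M borel_of T)"
  shows "{x \<in> space Z. meagre_in T (Pair x -` B)} \<in> sets Z"
proof -
  have cm: "completely_metrizable_space T"
    using T unfolding polish_topology_def by blast
  obtain \<B> where \<B>: "countable \<B>" "\<And>V. V \<in> \<B> \<Longrightarrow> openin T V"
      "\<And>U x. openin T U \<Longrightarrow> x \<in> U \<Longrightarrow> \<exists>V\<in>\<B>. x \<in> V \<and> V \<subseteq> U"
    using polish_imp_second_countable[OF T] unfolding second_countable_def by metis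
  \<comment> \<open>Meagreness is localised to every open \<open>U\<close> because the complement step for \<open>U\<close> needs the
    hypothesis for the basic open subsets of \<open>U\<close>.\<close>
  have meas: "\<forall>U. openin T U \<longrightarrow> {x \<in> space Z. meagre_in T (U \<inter> Pair x -` B)} \<in> sets Z"
    using B unfolding sets_pair_measure
  proof (induction rule: sigma_sets.induct)
    case (Basic R)
    then obtain S O' where R: "R = S \<times> O'" "S \<in> sets Z"
      by blast
    show ?case
    proof (intro allI impI)
      fix U
      have "{x \<in> space Z. meagre_in T (U \<inter> Pair x -` R)} =
          (if meagre_in T (U \<inter> O') then space Z else space Z - S)"
        unfolding R(1) by (auto elim: meagre_in_subset)
      then show "{x \<in> space Z. meagre_in T (U \<inter> Pair x -` R)} \<in> sets Z"
        using R(2) by auto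
    qed
  next
    case Empty
    then show ?case by simp
  next
    case (Compl R)
    then have R: "R \<in> sets (Z \<Otimes>\<^sub>M borel_of T)"
      unfolding sets_pair_measure by blast
    show ?case
    proof (intro allI impI)
      fix U assume U: "openin T U"
      have "meagre_in T (U \<inter> Pair x -` (space Z \<times> space (borel_of T) - R)) \<longleftrightarrow>
          (\<forall>V\<in>{V\<in>\<B>. V \<noteq> {} \<and> V \<subseteq> U}. \<not> meagre_in T (V \<inter> Pair x -` R))" if "x \<in> space Z" for x
      proof -
        have "U \<inter> Pair x -` (space Z \<times> space (borel_of T) - R) = U - Pair x -` R"
          using openin_subset[OF U] that by auto
        then show ?thesis
          using meagre_in_diff_iff[OF cm \<B>(2,3) borel_imp_baire_property U, of "Pair x -` R"]
            sets_Pair1[OF R] by auto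
      qed
      then have "{x \<in> space Z. meagre_in T (U \<inter> Pair x -` (space Z \<times> space (borel_of T) - R))} =
          {x \<in> space Z. \<forall>V\<in>{V\<in>\<B>. V \<noteq> {} \<and> V \<subseteq> U}. \<not> meagre_in T (V \<inter> Pair x -` R)}"
        by blast
      also have "\<dots> \<in> sets Z"
      proof (rule sets.sets_Collect_countable_All')
        fix V assume "V \<in> {V\<in>\<B>. V \<noteq> {} \<and> V \<subseteq> U}"
        then show "{x \<in> space Z. \<not> meagre_in T (V \<inter> Pair x -` R)} \<in> sets Z"
          using Compl.IH \<B>(2) by (intro sets.sets_Collect_neg) auto
      next
        show "countable {V\<in>\<B>. V \<noteq> {} \<and> V \<subseteq> U}"
          using \<B>(1) by auto
      qed
      finally show "{x \<in> space Z. meagre_in T (U \<inter> Pair x -` (space Z \<times> space (borel_of T) - R))}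
        \<in> sets Z" .
    qed
  next
    case (Union R)
    show ?case
    proof (intro allI impI)
      fix U assume U: "openin T U"
      have "meagre_in T (U \<inter> Pair x -` (\<Union>i. R i)) \<longleftrightarrow> (\<forall>i. meagre_in T (U \<inter> Pair x -` R i))" for x
      proof
        assume "\<forall>i. meagre_in T (U \<inter> Pair x -` R i)"
        then have "meagre_in T (\<Union>i. U \<inter> Pair x -` R i)"
          by (intro meagre_in_UN) auto
        then show "meagre_in T (U \<inter> Pair x -` (\<Union>i. R i))"
          by (rule meagre_in_subset) auto
      qed (auto elim!: meagre_in_subset)
      then show "{x \<in> space Z. meagre_in T (U \<inter> Pair x -` (\<Union>i. R i))} \<in> sets Z"
        using Union.IH U by (auto intro!: sets.sets_Collect_countable_All)
    qed
  qed
  have "topspace T \<inter> Pair x -` B = Pair x -` B" for x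
    using sets.sets_into_space[OF B] by (auto simp: space_pair_measure)
  with meas show ?thesis
    by (metis (no_types, lifting) Collect_cong openin_topspace)
qed

section \<open>Standard Borel and Polish spaces\<close>

text \<open>
  Distinct points are separated by a member of a countable base, so the complement of the diagonal
  is a countable union of measurable rectangles.
\<close>

lemma standard_borel_measurable_diagonal:
  assumes "standard_borel Z"
  shows "{p \<in> space (Z \<Otimes>\<^sub>M Z). fst p = snd p} \<in> sets (Z \<Otimes>\<^sub>M Z)"
proof -
  obtain T where T: "polish_topology T" "space Z = topspace T" "sets Z = sets (borel_of T)"
    using assms unfolding standard_borel_def by blast
  obtain \<B> where \<B>: "countable \<B>" "\<And>V. V \<in> \<B> \<Longrightarrow> openin T V"
      "\<And>U x. openin T U \<Longrightarrow> x \<in> U \<Longrightarrow> \<exists>V\<in>\<B>. x \<in> V \<and> V \<subseteq> U"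
    using polish_imp_second_countable[OF T(1)] unfolding second_countable_def by metis
  have "Hausdorff_space T"
    using T(1) unfolding polish_topology_def
    by (simp add: completely_metrizable_imp_metrizable_space metrizable_imp_Hausdorff_space)
  have sep: "\<exists>V\<in>\<B>. x \<in> V \<and> y \<notin> V" if xy: "x \<in> topspace T" "y \<in> topspace T" "x \<noteq> y" for x y
  proof -
    obtain U W where "openin T U" "openin T W" "x \<in> U" "y \<in> W" "disjnt U W"
      using \<open>Hausdorff_space T\<close> xy unfolding Hausdorff_space_def by blast
    then show ?thesis
      using \<B>(3)[of U x] unfolding disjnt_iff by blast
  qed
  have "{p \<in> space (Z \<Otimes>\<^sub>M Z). fst p = snd p} =
      space (Z \<Otimes>\<^sub>M Z) - (\<Union>V\<in>\<B>. V \<times> (space Z - V))"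
  proof (intro equalityI subsetI)
    fix p assume "p \<in> space (Z \<Otimes>\<^sub>M Z) - (\<Union>V\<in>\<B>. V \<times> (space Z - V))"
    moreover obtain x y where "p = (x, y)"
      by (cases p)
    ultimately show "p \<in> {p \<in> space (Z \<Otimes>\<^sub>M Z). fst p = snd p}"
      using sep[of x y] unfolding space_pair_measure T(2) by auto
  qed (auto simp: space_pair_measure)
  also have "\<dots> \<in> sets (Z \<Otimes>\<^sub>M Z)"
  proof (intro sets.compl_sets sets.countable_UN' image_subsetI)
    fix V assume "V \<in> \<B>"
    then have "V \<in> sets Z"
      using \<B>(2) open_in_sets_borel_of T(3) by blast
    then show "V \<times> (space Z - V) \<in> sets (Z \<Otimes>\<^sub>M Z)"
      by blast
  qed (rule \<B>(1))
  finally show ?thesis .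
qed

text \<open>
  The classical parametrisation of a Polish space by sequences of naturals. Fix a complete metric
  and a dense sequence \<open>D\<close>. The point coded by \<open>s\<close> is the unique \<open>g\<close> at distance at most
  \<open>1 / (n + 1)\<close> from \<open>D (s n)\<close> for every \<open>n\<close>; density gives each \<open>g\<close> a code.
\<close>

lemma polish_borel_image_of_Baire_space:
  assumes T: "polish_topology T" and ne: "topspace T \<noteq> {}"
  obtains f :: "(nat \<Rightarrow> nat) \<Rightarrow> 'a"
  where "f \<in> borel \<rightarrow>\<^sub>M borel_of T" and "range f = topspace T"
proof -
  obtain M d where M: "Metric_space M d" "Metric_space.mcomplete M d"
      "T = Metric_space.mtopology M d"
    using T unfolding polish_topology_def completely_metrizable_space_def by blast
  interpret Metric_space M d by (rule M)
  obtain C where C: "countable C" "C \<subseteq> M" "mtopology closure_of C = M"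
    using T unfolding polish_topology_def separable_space_def M(3) by auto
  have "C \<noteq> {}"
    using C(3) ne M(3) by auto
  define D where "D = from_nat_into C"
  have D: "range D = C"
    unfolding D_def using C(1) \<open>C \<noteq> {}\<close> by simp
  have DM: "D n \<in> M" for n
    using D C(2) by blast
  define r where "r n = 1 / real (Suc n)" for n
  have r0: "r n > 0" for n
    unfolding r_def by simp
  have r_tendsto: "\<exists>N. \<forall>n\<ge>N. r n < e" if e: "e > 0" for e
  proof -
    obtain N where "1 / real (Suc N) < e"
      using nat_approx_posE[OF e] by blast
    moreover have "r n \<le> 1 / real (Suc N)" if "n \<ge> N" for n
      unfolding r_def using that by (simp add: frac_le)
    ultimately show ?thesis
      by (meson le_less_trans)
  qed
  \<comment> \<open>The set of codes. Stated without the coded point, the condition is visibly Borel; by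
    completeness it already guarantees that a coded point exists.\<close>
  define S where "S = {s. \<forall>n m. d (D (s n)) (D (s m)) \<le> r n + r m}"
  have lim: "\<exists>g\<in>M. \<forall>n. d (D (s n)) g \<le> r n" if s: "s \<in> S" for s
  proof -
    have "MCauchy (\<lambda>n. D (s n))"
      unfolding MCauchy_def
    proof (intro conjI strip)
      show "range (\<lambda>n. D (s n)) \<subseteq> M"
        using DM by auto
      fix e :: real assume "e > 0"
      then obtain N where N: "\<And>n. n \<ge> N \<Longrightarrow> r n < e / 2"
        using r_tendsto[of "e / 2"] by auto
      have "d (D (s n)) (D (s m)) < e" if "n \<ge> N" "m \<ge> N" for n m
      proof -
        have "d (D (s n)) (D (s m)) \<le> r n + r m"
          using s unfolding S_def by blast
        with N[OF that(1)] N[OF that(2)] show ?thesis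
          by linarith
      qed
      then show "\<exists>N. \<forall>n n'. N \<le> n \<longrightarrow> N \<le> n' \<longrightarrow> d (D (s n)) (D (s n')) < e"
        by blast
    qed
    then obtain g where g: "limitin mtopology (\<lambda>n. D (s n)) g sequentially"
      using M(2) unfolding mcomplete_def by blast
    then have "g \<in> M"
      by (rule limitin_mspace)
    have "d (D (s n)) g \<le> r n" for n
    proof (rule field_le_epsilon)
      fix e :: real assume e: "e > 0"
      obtain N1 where N1: "\<And>m. m \<ge> N1 \<Longrightarrow> d (D (s m)) g < e / 2"
        using g e unfolding limit_metric_sequentially by (meson half_gt_zero)
      obtain N2 where N2: "\<And>m. m \<ge> N2 \<Longrightarrow> r m < e / 2"
        using r_tendsto[of "e / 2"] e by auto
      define m where "m = max N1 N2"
      have "d (D (s n)) g \<le> d (D (s n)) (D (s m)) + d (D (s m)) g"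
        using DM \<open>g \<in> M\<close> by (intro triangle)
      moreover have "d (D (s n)) (D (s m)) \<le> r n + r m"
        using s unfolding S_def by blast
      ultimately show "d (D (s n)) g \<le> r n + e"
        using N1[of m] N2[of m] unfolding m_def by linarith
    qed
    with \<open>g \<in> M\<close> show ?thesis
      by blast
  qed
  have unique: "g = h" if "g \<in> M" "h \<in> M" "\<And>n. d (D (s n)) g \<le> r n" "\<And>n. d (D (s n)) h \<le> r n"
    for g h s
  proof (rule ccontr)
    assume "g \<noteq> h"
    then have "d g h > 0"
      using that by simp
    then obtain n where "r n < d g h / 2"
      using r_tendsto[of "d g h / 2"] by auto
    moreover have "d g h \<le> d (D (s n)) g + d (D (s n)) h"
      using triangle''[of g "D (s n)" h] that DM by (simp add: commute)
    ultimately show False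
      using that(3)[of n] that(4)[of n] by linarith
  qed
  define f where "f s = (if s \<in> S then SOME g. g \<in> M \<and> (\<forall>n. d (D (s n)) g \<le> r n) else D 0)" for s
  have fS: "f s \<in> M \<and> (\<forall>n. d (D (s n)) (f s) \<le> r n)" if "s \<in> S" for s
    using someI_ex[of "\<lambda>g. g \<in> M \<and> (\<forall>n. d (D (s n)) g \<le> r n)"] lim[OF that] that
    unfolding f_def by auto
  have fM: "f s \<in> M" for s
    using fS DM by (cases "s \<in> S") (auto simp: f_def)
  \<comment> \<open>Conditions on one coordinate are Borel, the coordinates being discrete.\<close>
  have coord: "{s. P (s n)} \<in> sets borel" for P :: "nat \<Rightarrow> bool" and n :: nat
  proof -
    have "(\<lambda>s :: nat \<Rightarrow> nat. s n) -` {k. P k} \<inter> space borel \<in> sets borel"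
      by (rule measurable_sets[OF measurable_product_coordinates]) (simp add: borel_open open_discrete)
    then show ?thesis
      by (simp add: vimage_def)
  qed
  have S: "S \<in> sets borel"
  proof -
    have "{s. P (s n) (s m)} \<in> sets borel" for P :: "nat \<Rightarrow> nat \<Rightarrow> bool" and n m :: nat
    proof -
      have "{s. P (s n) (s m)} = (\<Union>k. {s. s n = k} \<inter> {s. P k (s m)})"
        by auto
      also have "\<dots> \<in> sets borel"
        using coord by (intro sets.countable_UN' sets.Int) auto
      finally show ?thesis .
    qed
    then have "(\<Inter>n. \<Inter>m. {s. d (D (s n)) (D (s m)) \<le> r n + r m}) \<in> sets borel"
      by (intro sets.countable_INT'') auto
    also have "(\<Inter>n. \<Inter>m. {s. d (D (s n)) (D (s m)) \<le> r n + r m}) = S"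
      unfolding S_def by blast
    finally show ?thesis .
  qed
  have "f \<in> borel \<rightarrow>\<^sub>M borel_of T"
    unfolding borel_of_def
  proof (rule measurable_measure_of)
    show "{U. openin T U} \<subseteq> Pow (topspace T)"
      by (auto dest: openin_subset)
    show "f \<in> space borel \<rightarrow> topspace T"
      using fM M(3) by auto
    fix U assume "U \<in> {U. openin T U}"
    then have U: "openin mtopology U"
      using M(3) by simp
    \<comment> \<open>Whether \<open>f s\<close> lies in the open set \<open>U\<close> is witnessed by a single coordinate of \<open>s\<close>; this
      makes the preimage of \<open>U\<close> measurable.\<close>
    have in_U: "f s \<in> U \<longleftrightarrow> (\<exists>n. mcball (D (s n)) (r n) \<subseteq> U)" if "s \<in> S" for s
    proof
      assume "f s \<in> U"
      then obtain e where e: "e > 0" "mball (f s) e \<subseteq> U"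
        using U unfolding openin_mtopology by blast
      then obtain n where n: "r n < e / 2"
        using r_tendsto[of "e / 2"] by auto
      have "mcball (D (s n)) (r n) \<subseteq> mball (f s) e"
      proof (rule mcball_subset_mball)
        show "d (D (s n)) (f s) + r n < e" "f s \<in> M"
          using fS[OF that] n add_le_less_mono[of "d (D (s n)) (f s)" "r n" "r n" "e / 2"]
          by (auto intro: add_mono order.strict_trans1 simp: field_simps)
      qed
      with e show "\<exists>n. mcball (D (s n)) (r n) \<subseteq> U"
        by blast
    next
      assume "\<exists>n. mcball (D (s n)) (r n) \<subseteq> U"
      then show "f s \<in> U"
        using fS[OF that] DM by auto
    qed
    have "f -` U \<inter> space borel =
        (S \<inter> (\<Union>n. {s. mcball (D (s n)) (r n) \<subseteq> U})) \<union> (if D 0 \<in> U then - S else {})"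
    proof (rule Set.set_eqI)
      fix s
      have "f s = D 0" if "s \<notin> S"
        using that by (simp add: f_def)
      then show "s \<in> f -` U \<inter> space borel \<longleftrightarrow>
          s \<in> (S \<inter> (\<Union>n. {s. mcball (D (s n)) (r n) \<subseteq> U})) \<union> (if D 0 \<in> U then - S else {})"
        using in_U[of s] by (cases "s \<in> S") simp_all
    qed
    also have "\<dots> \<in> sets borel"
      using S coord by (auto intro!: sets.Un sets.Int sets.countable_UN' borel_comp)
    finally show "f -` U \<inter> space borel \<in> sets borel" .
  qed
  moreover have "range f = topspace T"
  proof
    show "range f \<subseteq> topspace T"
      using fM M(3) by auto
    show "topspace T \<subseteq> range f"
    proof
      fix g assume "g \<in> topspace T"
      then have g: "g \<in> M"
        using M(3) by simp
      have "\<exists>k. d (D k) g \<le> r n" for n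
      proof -
        have "C \<inter> mball g (r n) \<noteq> {}"
          using C(3) dense_intersects_open[of mtopology C] g r0[of n]
          by (auto simp: mball_eq_empty)
        then obtain c where "c \<in> C" "d g c < r n"
          by auto
        then show ?thesis
          using D commute by (metis imageE less_imp_le)
      qed
      then obtain s where s: "\<And>n. d (D (s n)) g \<le> r n"
        by metis
      have "s \<in> S"
        unfolding S_def
      proof (intro CollectI allI)
        fix n m
        show "d (D (s n)) (D (s m)) \<le> r n + r m"
          using triangle'[OF DM g DM, of "s n" "s m"] s[of n] s[of m] by linarith
      qed
      then have "f s = g"
        using unique[of "f s" g s] fS s g by blast
      then show "g \<in> range f"
        by blast
    qed
  qed
  ultimately show ?thesis
    by (rule that)
qed

section \<open>Borel actions of Polish groups\<close>

locale polish_borel_action =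
  fixes G :: "('g, 'b) monoid_scheme" (structure) and T :: "'g topology"
    and Z :: "'z measure" and a :: "'g \<Rightarrow> 'z \<Rightarrow> 'z"
  assumes polish_group: "polish_group G T"
    and borel_action: "borel_action G T Z a"
begin

sublocale group_action G "space Z" a
  using borel_action unfolding borel_action_def by blast

sublocale group G
  using polish_group unfolding polish_group_def by blast

lemma polish: "polish_topology T"
  and topspace_eq_carrier: "topspace T = carrier G"
  using polish_group unfolding polish_group_def by blast+

lemma measurable_action: "(\<lambda>(g, z). a g z) \<in> borel_of T \<Otimes>\<^sub>M Z \<rightarrow>\<^sub>M Z"
  using borel_action unfolding borel_action_def by blast

lemma action_closed: "g \<in> carrier G \<Longrightarrow> y \<in> space Z \<Longrightarrow> a g y \<in> space Z"
  using element_image by blast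

lemma continuous_right_translation:
  assumes "h \<in> carrier G"
  shows "continuous_map T T (\<lambda>g. g \<otimes> h)"
proof -
  have "continuous_map T (prod_topology T T) (\<lambda>g. (g, h))"
    using assms topspace_eq_carrier by (simp add: continuous_map_pairedI)
  moreover have "continuous_map (prod_topology T T) T (\<lambda>(g, h). g \<otimes> h)"
    using polish_group unfolding polish_group_def by blast
  ultimately have "continuous_map T T ((\<lambda>(g, h). g \<otimes> h) \<circ> (\<lambda>g. (g, h)))"
    by (rule continuous_map_compose)
  then show ?thesis
    by (simp add: o_def)
qed

lemma homeomorphic_right_translation:
  assumes "h \<in> carrier G"
  shows "homeomorphic_map T T (\<lambda>g. g \<otimes> h)"
proof (rule homeomorphic_maps_imp_map)
  show "homeomorphic_maps T T (\<lambda>g. g \<otimes> h) (\<lambda>g. g \<otimes> inv h)"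
    using assms by (auto simp: homeomorphic_maps_def continuous_right_translation
        topspace_eq_carrier m_assoc)
qed

text \<open>
  Smallness is measured in the group, along the orbit map \<open>g \<mapsto> a g y\<close>, because the group is Polish,
  whereas in a topology inherited from \<open>Z\<close> an orbit may well be meagre in itself.
\<close>

definition orbit_meagre :: "'z \<Rightarrow> 'z set \<Rightarrow> bool" where
  "orbit_meagre y A \<longleftrightarrow> meagre_in T {g \<in> carrier G. a g y \<in> A}"

text \<open>
  Replacing the base point \<open>y\<close> by \<open>a h y\<close> moves the preimage by the right translation by \<open>inv h\<close>,
  a homeomorphism of the group.
\<close>

lemma orbit_meagre_translate:
  assumes h: "h \<in> carrier G" and y: "y \<in> space Z" and A: "orbit_meagre y A"
  shows "orbit_meagre (a h y) A"
proof -
  have "{g \<in> carrier G. a g (a h y) \<in> A} = (\<lambda>g. g \<otimes> inv h) ` {g \<in> carrier G. a g y \<in> A}"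
  proof (intro equalityI subsetI)
    fix g assume "g \<in> {g \<in> carrier G. a g (a h y) \<in> A}"
    then show "g \<in> (\<lambda>g. g \<otimes> inv h) ` {g \<in> carrier G. a g y \<in> A}"
      using h y composition_rule[OF y, of g h]
      by (intro image_eqI[of _ _ "g \<otimes> h"]) (auto simp: m_assoc)
  next
    fix g assume "g \<in> (\<lambda>g. g \<otimes> inv h) ` {g \<in> carrier G. a g y \<in> A}"
    then obtain k where k: "g = k \<otimes> inv h" "k \<in> carrier G" "a k y \<in> A"
      by blast
    have "a g (a h y) = a (g \<otimes> h) y"
      using composition_rule[OF y, of g h] k h by simp
    also have "g \<otimes> h = k"
      using k h by (simp add: m_assoc)
    finally show "g \<in> {g \<in> carrier G. a g (a h y) \<in> A}"
      using k h by simp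
  qed
  then show ?thesis
    using meagre_in_homeomorphic_image[OF homeomorphic_right_translation A[unfolded orbit_meagre_def]] h
    unfolding orbit_meagre_def by simp
qed

lemma orbit_meagre_orbit_cong:
  assumes y: "y \<in> space Z" and x: "x \<in> orbit G a y"
  shows "orbit_meagre x A \<longleftrightarrow> orbit_meagre y A"
proof -
  obtain h where h: "h \<in> carrier G" "x = a h y"
    using x unfolding orbit_def by blast
  then have "x \<in> space Z" "a (inv h) x = y"
    using y action_closed orbit_sym_aux by auto
  with h y show ?thesis
    using orbit_meagre_translate[of h y A] orbit_meagre_translate[of "inv h" x A] by auto
qed

lemma orbit_meagre_subset: "orbit_meagre y B \<Longrightarrow> A \<subseteq> B \<Longrightarrow> orbit_meagre y A"
  unfolding orbit_meagre_def by (erule meagre_in_subset) auto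

lemma orbit_meagre_empty [simp]: "orbit_meagre y {}"
  unfolding orbit_meagre_def by simp

lemma orbit_meagre_UN:
  fixes A :: "nat \<Rightarrow> 'z set"
  assumes "\<And>n. orbit_meagre y (A n)"
  shows "orbit_meagre y (\<Union>n. A n)"
proof -
  have "meagre_in T (\<Union>n. {g \<in> carrier G. a g y \<in> A n})"
    using assms unfolding orbit_meagre_def by (intro meagre_in_UN) auto
  then show ?thesis
    unfolding orbit_meagre_def by (rule meagre_in_subset) auto
qed

lemma not_orbit_meagre_orbit:
  assumes "orbit G a y \<subseteq> A"
  shows "\<not> orbit_meagre y A"
proof
  assume "orbit_meagre y A"
  moreover have "{g \<in> carrier G. a g y \<in> A} = topspace T"
    using assms unfolding orbit_def topspace_eq_carrier by blast
  ultimately have "topspace T = {}"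
    using meagre_in_open_imp_empty[of T "topspace T"] polish
    unfolding orbit_meagre_def polish_topology_def by simp
  then show False
    using one_closed topspace_eq_carrier by simp
qed

lemma borel_orbit_map_vimage:
  assumes y: "y \<in> space Z" and A: "A \<in> sets Z"
  shows "{g \<in> carrier G. a g y \<in> A} \<in> sets (borel_of T)"
proof -
  have "(\<lambda>g. (g, y)) \<in> borel_of T \<rightarrow>\<^sub>M borel_of T \<Otimes>\<^sub>M Z"
    using y by (rule measurable_Pair2')
  from measurable_sets[OF measurable_compose[OF this measurable_action] A]
  show ?thesis
    by (simp add: vimage_def Int_def topspace_eq_carrier conj_commute)
qed

text \<open>
  Preimages under the orbit map are Borel, hence have the Baire property, and preimages of disjoint
  sets are disjoint; so the chain condition is inherited from the meagre ideal of the group.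
\<close>

lemma ccc_orbit_meagre:
  assumes y: "y \<in> space Z" and C: "orbit G a y \<subseteq> C"
    and \<A>: "\<A> \<subseteq> sets (restrict_space Z C)" "disjoint \<A>"
    and nonmeagre: "\<And>A. A \<in> \<A> \<Longrightarrow> \<not> orbit_meagre y A"
  shows "countable \<A>"
proof (rule nonmeagre_disjoint_family_countable[OF polish])
  fix A assume A: "A \<in> \<A>"
  then obtain B where B: "A = C \<inter> B" "B \<in> sets Z"
    using \<A>(1) unfolding sets_restrict_space by blast
  have "{g \<in> carrier G. a g y \<in> A} = {g \<in> carrier G. a g y \<in> B}"
    using C B(1) unfolding orbit_def by blast
  then show "baire_property T {g \<in> carrier G. a g y \<in> A}"
    using borel_orbit_map_vimage[OF y B(2)] borel_imp_baire_property by simp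
  show "\<not> meagre_in T {g \<in> carrier G. a g y \<in> A}"
    using nonmeagre[OF A] unfolding orbit_meagre_def .
next
  fix A B assume "A \<in> \<A>" "B \<in> \<A>" "A \<noteq> B"
  then show "{g \<in> carrier G. a g y \<in> A} \<inter> {g \<in> carrier G. a g y \<in> B} = {}"
    using \<A>(2) unfolding pairwise_def disjnt_iff by blast
qed

text \<open>
  Pulling \<open>A\<close> back along \<open>(x, g) \<mapsto> (x, a g (f x))\<close> turns the assertion into one about meagre sections
  of a Borel subset of \<open>Z \<times> G\<close>.
\<close>

lemma measurable_orbit_meagre_sections:
  assumes f: "f \<in> Z \<rightarrow>\<^sub>M Z" and A: "A \<in> sets (Z \<Otimes>\<^sub>M Z)"
  shows "{x \<in> space Z. orbit_meagre (f x) {y. (x, y) \<in> A}} \<in> sets Z"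
proof -
  have "(\<lambda>p. (fst p, (\<lambda>(g, z). a g z) (snd p, f (fst p)))) \<in> Z \<Otimes>\<^sub>M borel_of T \<rightarrow>\<^sub>M Z \<Otimes>\<^sub>M Z"
    by (intro measurable_Pair measurable_fst measurable_compose[OF _ measurable_action]
        measurable_snd measurable_compose[OF measurable_fst f])
  from measurable_sets[OF this A]
  have B: "{p \<in> space (Z \<Otimes>\<^sub>M borel_of T). (fst p, a (snd p) (f (fst p))) \<in> A}
      \<in> sets (Z \<Otimes>\<^sub>M borel_of T)"
    by (simp add: vimage_def Int_def conj_commute)
  have "Pair x -` {p \<in> space (Z \<Otimes>\<^sub>M borel_of T). (fst p, a (snd p) (f (fst p))) \<in> A} =
      {g \<in> carrier G. a g (f x) \<in> {y. (x, y) \<in> A}}" if "x \<in> space Z" for x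
    using that by (auto simp: space_pair_measure topspace_eq_carrier)
  with measurable_meagre_sections[OF polish B] show ?thesis
    unfolding orbit_meagre_def by (simp cong: conj_cong)
qed

text \<open>
  The relation is the projection along the group of the Borel set of triples \<open>(x, y, g)\<close> with
  \<open>a g (f x) = f y\<close>; the Baire space enters through a Borel map onto the group.
\<close>

lemma analytic_orbit_relation:
  assumes Z: "standard_borel Z" and f: "f \<in> Z \<rightarrow>\<^sub>M Z"
  shows "analytic_in (Z \<Otimes>\<^sub>M Z) {(x, y). x \<in> space Z \<and> y \<in> space Z \<and> f y \<in> orbit G a (f x)}"
proof -
  let ?N = "borel :: (nat \<Rightarrow> nat) measure"
  have "topspace T \<noteq> {}"
    using one_closed topspace_eq_carrier by auto
  then obtain c :: "(nat \<Rightarrow> nat) \<Rightarrow> 'g" where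
    c: "c \<in> ?N \<rightarrow>\<^sub>M borel_of T" "range c = topspace T"
    using polish_borel_image_of_Baire_space[OF polish] by blast
  have c_carrier: "range c = carrier G"
    using c(2) topspace_eq_carrier by simp
  define B where "B = {p \<in> space ((Z \<Otimes>\<^sub>M Z) \<Otimes>\<^sub>M ?N).
      a (c (snd p)) (f (fst (fst p))) = f (snd (fst p))}"
  have "(\<lambda>p. ((\<lambda>(g, z). a g z) (c (snd p), f (fst (fst p))), f (snd (fst p))))
      \<in> (Z \<Otimes>\<^sub>M Z) \<Otimes>\<^sub>M ?N \<rightarrow>\<^sub>M Z \<Otimes>\<^sub>M Z"
    by (intro measurable_Pair measurable_compose[OF _ measurable_action]
        measurable_compose[OF _ f] measurable_compose[OF measurable_snd c(1)]
        measurable_compose[OF measurable_fst measurable_fst]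
        measurable_compose[OF measurable_fst measurable_snd])
  from measurable_sets[OF this standard_borel_measurable_diagonal[OF Z]]
  have "B \<in> sets ((Z \<Otimes>\<^sub>M Z) \<Otimes>\<^sub>M ?N)"
  proof (rule back_subst[of "\<lambda>X. X \<in> sets ((Z \<Otimes>\<^sub>M Z) \<Otimes>\<^sub>M ?N)"], intro equalityI subsetI)
    fix p assume "p \<in> B"
    then show "p \<in> (\<lambda>p. ((\<lambda>(g, z). a g z) (c (snd p), f (fst (fst p))), f (snd (fst p)))) -`
        {p \<in> space (Z \<Otimes>\<^sub>M Z). fst p = snd p} \<inter> space ((Z \<Otimes>\<^sub>M Z) \<Otimes>\<^sub>M ?N)"
      using measurable_space[OF f] by (auto simp: B_def space_pair_measure)
  qed (auto simp: B_def)
  moreover have "{(x, y). x \<in> space Z \<and> y \<in> space Z \<and> f y \<in> orbit G a (f x)} = fst ` B"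
  proof (intro equalityI subsetI)
    fix p assume "p \<in> {(x, y). x \<in> space Z \<and> y \<in> space Z \<and> f y \<in> orbit G a (f x)}"
    then obtain x y g where p: "p = (x, y)" "x \<in> space Z" "y \<in> space Z"
      and g: "g \<in> carrier G" "f y = a g (f x)"
      unfolding orbit_def by blast
    obtain s where "g = c s"
      using g(1) c_carrier by blast
    then have "(p, s) \<in> B"
      using p g by (auto simp: B_def space_pair_measure)
    then show "p \<in> fst ` B"
      by force
  next
    fix p assume "p \<in> fst ` B"
    then obtain x y s where "p = (x, y)" "((x, y), s) \<in> B"
      by force
    moreover have "c s \<in> carrier G"
      using c_carrier by blast
    moreover from this have "a (c s) (f x) \<in> orbit G a (f x)"
      unfolding orbit_def by blast
    ultimately show "p \<in> {(x, y). x \<in> space Z \<and> y \<in> space Z \<and> f y \<in> orbit G a (f x)}"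
      by (auto simp: B_def space_pair_measure)
  qed
  ultimately show ?thesis
    unfolding analytic_in_def by blast
qed

end

section \<open>Idealistic equivalence relations\<close>

theorem proposition2p4:
  fixes G :: "('g, 'b) monoid_scheme" and T :: "'g topology"
    and Z :: "'z measure" and a :: "'g \<Rightarrow> 'z \<Rightarrow> 'z"
    and E F :: "('z \<times> 'z) set" and \<theta> :: "'z \<Rightarrow> 'z"
  assumes "polish_group G T"
    and "standard_borel Z"
    and "borel_action G T Z a"
    and "E = orbit_equivalence G (space Z) a"
    and "equiv (space Z) F"
    and "E \<subseteq> F"
    and "\<theta> \<in> Z \<rightarrow>\<^sub>M Z"
    and "selects_class (space Z) E F \<theta>"
  shows "idealistic Z F"
proof -
  interpret polish_borel_action G T Z a
    by unfold_locales (fact assms)+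
  note F = \<open>equiv (space Z) F\<close>
  have F_space: "F \<subseteq> space Z \<times> space Z"
    using F by (rule equiv_type)
  have F_sym: "(y, x) \<in> F" if "(x, y) \<in> F" for x y
    using F that by (meson equivE symD)
  have F_trans: "(x, z) \<in> F" if "(x, y) \<in> F" "(y, z) \<in> F" for x y z
    using F that by (meson equivE transD)
  have \<theta>_space: "\<theta> x \<in> space Z" if "x \<in> space Z" for x
    using assms(7) that by (rule measurable_space)
  have \<theta>_F: "(\<theta> x, x) \<in> F" if "x \<in> space Z" for x
    using assms(8) that unfolding selects_class_def by blast
  have \<theta>_hom: "\<theta> y \<in> orbit G a (\<theta> x)" if "(x, y) \<in> F" for x y
    using assms(4,8) that unfolding selects_class_def orbit_equivalence_def by blast
  have orbit_F: "(x, y) \<in> F" if "x \<in> space Z" "y \<in> orbit G a x" for x y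
    using assms(4,6) that unfolding orbit_equivalence_def by blast
  have orbit_in_class: "orbit G a (\<theta> z) \<subseteq> F `` {x}" if "(x, z) \<in> F" for x z
  proof
    fix y assume y: "y \<in> orbit G a (\<theta> z)"
    have z: "z \<in> space Z"
      using that F_space by blast
    have "(\<theta> z, y) \<in> F"
      using orbit_F[OF \<theta>_space[OF z] y] .
    then show "y \<in> F `` {x}"
      using that F_sym[OF \<theta>_F[OF z]] F_trans by blast
  qed
  \<comment> \<open>Thus \<open>\<theta>\<close> reduces \<open>F\<close> to the orbit equivalence relation, which makes \<open>F\<close> analytic.\<close>
  have F_reduction: "F = {(x, y). x \<in> space Z \<and> y \<in> space Z \<and> \<theta> y \<in> orbit G a (\<theta> x)}"
  proof (intro equalityI subrelI)
    fix x y assume "(x, y) \<in> F"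
    then show "(x, y) \<in> {(x, y). x \<in> space Z \<and> y \<in> space Z \<and> \<theta> y \<in> orbit G a (\<theta> x)}"
      using F_space \<theta>_hom by blast
  next
    fix x y assume "(x, y) \<in> {(x, y). x \<in> space Z \<and> y \<in> space Z \<and> \<theta> y \<in> orbit G a (\<theta> x)}"
    then have xy: "x \<in> space Z" "y \<in> space Z" "\<theta> y \<in> orbit G a (\<theta> x)"
      by auto
    have "(\<theta> x, \<theta> y) \<in> F"
      using orbit_F \<theta>_space xy by blast
    then show "(x, y) \<in> F"
      using F_sym[OF \<theta>_F[OF xy(1)]] \<theta>_F[OF xy(2)] F_trans by blast
  qed

  \<comment> \<open>Any one base point would give the same ideal; quantifying over all of them avoids choosing a
    point of the class.\<close>
  define I where "I C = {A. A \<subseteq> C \<and> (\<forall>z\<in>C. orbit_meagre (\<theta> z) A)}" for C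
  have I_iff: "A \<in> I (F `` {x}) \<longleftrightarrow> A \<subseteq> F `` {x} \<and> orbit_meagre (\<theta> x) A"
    if x: "x \<in> space Z" for x A
  proof -
    have "orbit_meagre (\<theta> z) A \<longleftrightarrow> orbit_meagre (\<theta> x) A" if "(x, z) \<in> F" for z
      using orbit_meagre_orbit_cong[OF \<theta>_space[OF x] \<theta>_hom[OF that]] .
    moreover have "(x, x) \<in> F"
      using F x by (meson equivE refl_onD)
    ultimately show ?thesis
      unfolding I_def by blast
  qed
  have ideal: "sigma_ideal_on C (I C) \<and> C \<notin> I C \<and> ccc_ideal Z C (I C)" if C: "C \<in> space Z // F" for C
  proof -
    obtain x where x: "x \<in> space Z" "C = F `` {x}"
      using C by (rule quotientE)
    have orb: "orbit G a (\<theta> x) \<subseteq> C"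
      unfolding x(2) using F x(1) by (intro orbit_in_class) (meson equivE refl_onD)
    note mem = I_iff[OF x(1), folded x(2)]
    show ?thesis
    proof (intro conjI)
      show "sigma_ideal_on C (I C)"
        unfolding sigma_ideal_on_def
      proof (intro conjI allI impI)
        show "I C \<subseteq> Pow C" "{} \<in> I C"
          by (auto simp: mem)
        show "B \<in> I C" if "A \<in> I C \<and> B \<subseteq> A" for A B
          using that orbit_meagre_subset[of "\<theta> x" A B] unfolding mem by blast
        show "(\<Union>n. A n) \<in> I C" if "range A \<subseteq> I C" for A :: "nat \<Rightarrow> 'z set"
        proof -
          have "A n \<subseteq> C \<and> orbit_meagre (\<theta> x) (A n)" for n
            using that mem by blast
          then show ?thesis
            unfolding mem by (intro conjI orbit_meagre_UN) auto
        qed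
      qed
      show "C \<notin> I C"
        using not_orbit_meagre_orbit[OF orb] by (simp add: mem)
      show "ccc_ideal Z C (I C)"
        unfolding ccc_ideal_def
      proof (intro allI impI)
        fix \<A> assume \<A>: "\<A> \<subseteq> sets (restrict_space Z C) \<and> disjoint \<A> \<and> \<A> \<inter> I C = {}"
        have nonmeagre: "\<not> orbit_meagre (\<theta> x) A" if "A \<in> \<A>" for A
        proof -
          have "A \<subseteq> C"
            using that \<A> unfolding sets_restrict_space by blast
          then show ?thesis
            using that \<A> mem by blast
        qed
        show "countable \<A>"
          by (rule ccc_orbit_meagre[OF \<theta>_space[OF x(1)] orb _ _ nonmeagre]) (use \<A> in simp_all)
      qed
    qed
  qed
  have borel: "{x \<in> space Z. {y \<in> F `` {x}. (x, y) \<in> A} \<in> I (F `` {x})} \<in> sets Z"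
    if A: "A \<in> sets (Z \<Otimes>\<^sub>M Z)" for A
  proof -
    have "{y \<in> F `` {x}. (x, y) \<in> A} \<in> I (F `` {x}) \<longleftrightarrow> orbit_meagre (\<theta> x) {y. (x, y) \<in> A}"
      if x: "x \<in> space Z" for x
    proof -
      have "orbit G a (\<theta> x) \<subseteq> F `` {x}"
        using F x by (intro orbit_in_class) (meson equivE refl_onD)
      then have "{g \<in> carrier G. a g (\<theta> x) \<in> {y \<in> F `` {x}. (x, y) \<in> A}} =
          {g \<in> carrier G. a g (\<theta> x) \<in> {y. (x, y) \<in> A}}"
        unfolding orbit_def by blast
      moreover have "{y \<in> F `` {x}. (x, y) \<in> A} \<subseteq> F `` {x}"
        by blast
      ultimately show ?thesis
        unfolding I_iff[OF x] orbit_meagre_def by simp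
    qed
    then have "{x \<in> space Z. {y \<in> F `` {x}. (x, y) \<in> A} \<in> I (F `` {x})} =
        {x \<in> space Z. orbit_meagre (\<theta> x) {y. (x, y) \<in> A}}"
      by (intro Collect_cong conj_cong refl)
    then show ?thesis
      using measurable_orbit_meagre_sections[OF assms(7) A] by simp
  qed
  have analytic: "analytic_in (Z \<Otimes>\<^sub>M Z) F"
    by (subst F_reduction) (rule analytic_orbit_relation[OF assms(2,7)])
  show ?thesis
    unfolding idealistic_def
    by (intro conjI exI[of _ I] ballI assms(2) F analytic ideal borel)
qed

end
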